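(* Let $P=\{1,\dots,n\}$, let $\mathcal H^{(a)}$ ($a\in P$) be complex Hilbert spaces of finite dimension $d_a$, and let $d=\prod_{a\in P}d_a$. For every subset $S\subseteq P$ and every density operator $\rho$ on $\mathcal H^{(1)}\otimes\cdots\otimes\mathcal H^{(n)}$, the quantity $$L_S(\rho)=\sum_{\sigma\in\mathcal B_S}\bigl(\operatorname{tr}(\rho\,\sigma)\bigr)^2=d\,\operatorname{tr}\bigl(\xi_S(\rho)^2\bigr)$$ (the squared length of the projection of $\rho$ onto $\operatorname{span}_{\mathbb R}(\mathcal B_S)$, up to the normalization factor $d$) is invariant under local unitary transformations, i.e. $L_S(U\rho U^\dagger)=L_S(\rho)$ for all $U=U^{(1)}\otimes\cdots\otimes U^{(n)}$ with each $U^{(a)}$ unitary on $\mathcal H^{(a)}$.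
   Context: For each party $a\in P$ fix hermitian operators $\sigma^{(a)}_0=\mathbf 1,\sigma^{(a)}_1,\dots,\sigma^{(a)}_{d_a^2-1}$ on $\mathcal H^{(a)}$ with $\operatorname{tr}(\sigma^{(a)}_i\sigma^{(a)}_j)=d_a\,\delta_{ij}$; in particular $\sigma_i^{(a)}$ is traceless for $i\ge 1$, and these operators form a real orthogonal basis of the hermitian operators on $\mathcal H^{(a)}$. The product operators $\sigma^{(1)}_{i_1}\otimes\cdots\otimes\sigma^{(n)}_{i_n}$ with $0\le i_a\le d_a^2-1$ form a basis $\mathcal B$ of the real vector space of hermitian operators on $\mathcal H^{(1)}\otimes\cdots\otimes\mathcal H^{(n)}$, equipped with the scalar product $\langle A,B\rangle=\operatorname{tr}(AB)$. For $S\subseteq P$, the set $\mathcal B_S$ of $S$-correlation operators consists of those elements of $\mathcal B$ for which $\{a\in P: i_a\neq 0\}=S$. The projection of $\rho$ onto $\operatorname{span}_{\mathbb R}(\mathcal B_S)$ is $\xi_S(\rho)=\frac1d\sum_{\sigma\in\mathcal B_S}\operatorname{tr}(\rho\,\sigma)\,\sigma$. The number $L_S(\rho)$ is called the $S$-correlation strength of $\rho$. *)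

theory Defs
  imports "Jordan_Normal_Form.Schur_Decomposition"
begin

definition mat_trace :: "complex mat \<Rightarrow> complex" where
  "mat_trace A = (\<Sum>i<dim_row A. A $$ (i, i))"

definition hermitian_mat :: "complex mat \<Rightarrow> bool" where
  "hermitian_mat A \<longleftrightarrow> mat_adjoint A = A"

definition unitary_mat :: "nat \<Rightarrow> complex mat \<Rightarrow> bool" where
  "unitary_mat k U \<longleftrightarrow> U \<in> carrier_mat k k \<and>
     U * mat_adjoint U = 1\<^sub>m k \<and> mat_adjoint U * U = 1\<^sub>m k"

text \<open>The order on the complex numbers is the one of \<^theory>\<open>HOL-Library.Complex_Order\<close>:
  \<open>0 \<le> z\<close> says that \<open>z\<close> is real and nonnegative.\<close>

definition density_operator :: "nat \<Rightarrow> complex mat \<Rightarrow> bool" where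
  "density_operator k A \<longleftrightarrow> A \<in> carrier_mat k k \<and> hermitian_mat A \<and>
     (\<forall>v\<in>carrier_vec k. 0 \<le> (A *\<^sub>v v) \<bullet>c v) \<and> mat_trace A = 1"

text \<open>Row \<open>(i, i')\<close> of a Kronecker product is stored at position \<open>i * dim_row B + i'\<close>, and
  likewise for columns.\<close>

definition kronecker :: "complex mat \<Rightarrow> complex mat \<Rightarrow> complex mat" where
  "kronecker A B = mat (dim_row A * dim_row B) (dim_col A * dim_col B)
     (\<lambda>(i, j). A $$ (i div dim_row B, j div dim_col B) * B $$ (i mod dim_row B, j mod dim_col B))"

text \<open>\<open>tensor n A\<close> is \<open>A 1 \<otimes> \<dots> \<otimes> A n\<close>. Party \<open>a\<close> has local space \<open>\<complex>\<close> to the power \<open>d a\<close>, and the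
  tensor product of the local spaces is \<open>\<complex>\<close> to the power \<open>total_dim n d\<close>.\<close>

fun tensor :: "nat \<Rightarrow> (nat \<Rightarrow> complex mat) \<Rightarrow> complex mat" where
  "tensor 0 A = 1\<^sub>m 1"
| "tensor (Suc n) A = kronecker (tensor n A) (A (Suc n))"

definition total_dim :: "nat \<Rightarrow> (nat \<Rightarrow> nat) \<Rightarrow> nat" where
  "total_dim n d = (\<Prod>a\<in>{1..n}. d a)"

definition local_operator_basis :: "nat \<Rightarrow> (nat \<Rightarrow> complex mat) \<Rightarrow> bool" where
  "local_operator_basis k s \<longleftrightarrow>
     s 0 = 1\<^sub>m k \<and>
     (\<forall>i<k\<^sup>2. s i \<in> carrier_mat k k \<and> hermitian_mat (s i)) \<and>
     (\<forall>i<k\<^sup>2. \<forall>j<k\<^sup>2. mat_trace (s i * s j) = (if i = j then of_nat k else 0))"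

definition correlation_operators ::
  "nat \<Rightarrow> (nat \<Rightarrow> nat) \<Rightarrow> (nat \<Rightarrow> nat \<Rightarrow> complex mat) \<Rightarrow> nat set \<Rightarrow> complex mat set" where
  "correlation_operators n d \<sigma> S =
     {tensor n (\<lambda>a. \<sigma> a (i a)) | i.
        i \<in> (\<Pi>\<^sub>E a\<in>{1..n}. {..<(d a)\<^sup>2}) \<and> {a\<in>{1..n}. i a \<noteq> 0} = S}"

text \<open>For a hermitian \<open>\<rho>\<close> the traces below are real, so the value is a real number, regarded as
  an element of the complex numbers.\<close>

definition correlation_strength ::
  "nat \<Rightarrow> (nat \<Rightarrow> nat) \<Rightarrow> (nat \<Rightarrow> nat \<Rightarrow> complex mat) \<Rightarrow> nat set \<Rightarrow> complex mat \<Rightarrow> complex" where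
  "correlation_strength n d \<sigma> S \<rho> =
     (\<Sum>s\<in>correlation_operators n d \<sigma> S. (mat_trace (\<rho> * s))\<^sup>2)"

abbreviation mat_sum :: "nat \<Rightarrow> ('b \<Rightarrow> complex mat) \<Rightarrow> 'b set \<Rightarrow> complex mat" where
  "mat_sum k f A \<equiv> finsum (module_mat TYPE(complex) k k) f A"

definition correlation_projection ::
  "nat \<Rightarrow> (nat \<Rightarrow> nat) \<Rightarrow> (nat \<Rightarrow> nat \<Rightarrow> complex mat) \<Rightarrow> nat set \<Rightarrow> complex mat \<Rightarrow> complex mat" where
  "correlation_projection n d \<sigma> S \<rho> =
     (1 / of_nat (total_dim n d)) \<cdot>\<^sub>m
       mat_sum (total_dim n d) (\<lambda>s. mat_trace (\<rho> * s) \<cdot>\<^sub>m s) (correlation_operators n d \<sigma> S)"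

text \<open>The real span of a finite set of \<open>k \<times> k\<close> matrices.\<close>

definition real_span :: "nat \<Rightarrow> complex mat set \<Rightarrow> complex mat set" where
  "real_span k A = {mat_sum k (\<lambda>s. of_real (c s) \<cdot>\<^sub>m s) A | c :: complex mat \<Rightarrow> real. True}"

text \<open>\<open>X\<close> is the projection of \<open>M\<close> onto the subspace \<open>W\<close>, orthogonal for the scalar product
  \<open>\<langle>A, B\<rangle> = tr (A B)\<close>.\<close>

definition is_projection_onto :: "complex mat set \<Rightarrow> complex mat \<Rightarrow> complex mat \<Rightarrow> bool" where
  "is_projection_onto W M X \<longleftrightarrow> X \<in> W \<and> (\<forall>Y\<in>W. mat_trace ((M - X) * Y) = 0)"

end

theory Submission
  imports Defs
begin

text \<open>Conjugation \<open>X \<mapsto> U\<^sup>\<dagger> X U\<close> by a local unitary fixes the identity and transforms the traceless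
  hermitian operators isometrically, so in the basis \<open>\<sigma>\<^sub>0, \<sigma>\<^sub>1, \<dots>\<close> it is given by an orthogonal matrix
  \<open>R\<close> that is block diagonal for \<open>{0}\<close> and its complement. On product operators \<open>U\<close> therefore acts by
  the product of these matrices, which is orthogonal and does not mix different supports \<open>S\<close>; hence
  the vector of traces \<open>tr (\<rho> \<sigma>)\<close>, \<open>\<sigma> \<in> \<B>\<^sub>S\<close>, keeps its length.\<close>

section \<open>Traces and adjoints\<close>

text \<open>The index range splits into \<open>m\<close> consecutive blocks of length
  \<open>k\<close>. This serves both for Kronecker indices and for flattening a \<open>k\<close> by
  \<open>k\<close> matrix into a vector.\<close>

lemma sum_prod_div_mod:
  fixes f :: "nat \<Rightarrow> nat \<Rightarrow> 'a :: comm_monoid_add"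
  shows "(\<Sum>x<m * k. f (x div k) (x mod k)) = (\<Sum>i<m. \<Sum>j<k. f i j)"
proof -
  have "(\<Sum>x<m * k. f (x div k) (x mod k))
      = (\<Sum>i<m. \<Sum>x\<in>{i * k..<i * k + k}. f (x div k) (x mod k))"
    by (simp add: sum.nat_group)
  also have "\<dots> = (\<Sum>i<m. \<Sum>j<k. f i j)"
  proof (rule sum.cong[OF refl])
    fix i
    have "(\<Sum>x\<in>{i * k..<i * k + k}. f (x div k) (x mod k))
        = (\<Sum>j\<in>{0..<k}. f ((j + i * k) div k) ((j + i * k) mod k))"
      using sum.shift_bounds_nat_ivl[of "\<lambda>x. f (x div k) (x mod k)" 0 "i * k" k]
      by (simp add: add.commute)
    also have "\<dots> = (\<Sum>j<k. f i j)"
      by (rule sum.cong) auto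
    finally show "(\<Sum>x\<in>{i * k..<i * k + k}. f (x div k) (x mod k)) = (\<Sum>j<k. f i j)" .
  qed
  finally show ?thesis .
qed

lemma sum_swap3:
  "(\<Sum>i\<in>A. \<Sum>j\<in>B. \<Sum>l\<in>C. f i j l) = (\<Sum>j\<in>B. \<Sum>l\<in>C. \<Sum>i\<in>A. f i j l)"
  by (subst sum.swap, rule sum.cong[OF refl], rule sum.swap)

lemma index_mult_mat_sum:
  assumes "A \<in> carrier_mat n k" "B \<in> carrier_mat k m" "i < n" "j < m"
  shows "(A * B) $$ (i, j) = (\<Sum>l<k. A $$ (i, l) * B $$ (l, j))"
  using assms by (auto simp: scalar_prod_def atLeast0LessThan intro!: sum.cong)

lemma mat_trace_mult:
  assumes "A \<in> carrier_mat n k" "B \<in> carrier_mat k n"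
  shows "mat_trace (A * B) = (\<Sum>i<n. \<Sum>j<k. A $$ (i, j) * B $$ (j, i))"
  using assms
  by (auto simp: mat_trace_def index_mult_mat_sum[OF assms] simp del: index_mult_mat(1)
      intro!: sum.cong)

lemma mat_trace_comm:
  assumes "A \<in> carrier_mat n k" "B \<in> carrier_mat k n"
  shows "mat_trace (A * B) = mat_trace (B * A)"
  unfolding mat_trace_mult[OF assms] mat_trace_mult[OF assms(2,1)]
  by (subst sum.swap) (simp add: mult.commute)

lemma mat_adjoint_carrier:
  assumes "A \<in> carrier_mat n k"
  shows "mat_adjoint A \<in> carrier_mat k n"
  using assms unfolding mat_adjoint_def by (auto simp: mat_of_rows_def)

lemma mat_adjoint_index:
  assumes "A \<in> carrier_mat n k" "i < k" "j < n"
  shows "mat_adjoint A $$ (i, j) = cnj (A $$ (j, i))"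
  using assms unfolding mat_adjoint_def
  by (auto simp: mat_of_rows_def)

text \<open>Complex conjugation turns \<open>mat_trace (A * B)\<close> into
  \<open>mat_trace (B * A)\<close>, and the trace does not see the order of two factors.\<close>

lemma mat_trace_mult_hermitian_real:
  assumes "A \<in> carrier_mat n n" "B \<in> carrier_mat n n" "hermitian_mat A" "hermitian_mat B"
  shows "mat_trace (A * B) \<in> \<real>"
proof -
  have A: "cnj (A $$ (i, j)) = A $$ (j, i)" if "i < n" "j < n" for i j
    using mat_adjoint_index[OF assms(1) that(2,1)] assms(3) by (simp add: hermitian_mat_def)
  have B: "cnj (B $$ (i, j)) = B $$ (j, i)" if "i < n" "j < n" for i j
    using mat_adjoint_index[OF assms(2) that(2,1)] assms(4) by (simp add: hermitian_mat_def)
  have "cnj (mat_trace (A * B)) = mat_trace (B * A)"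
    unfolding mat_trace_mult[OF assms(1,2)] mat_trace_mult[OF assms(2,1)]
    by (simp add: A B mult.commute)
  also have "\<dots> = mat_trace (A * B)"
    by (rule mat_trace_comm[OF assms(2,1)])
  finally show ?thesis
    by (simp add: Reals_cnj_iff)
qed

section \<open>Finite sums of matrices\<close>

lemma mat_sum_carrier:
  assumes "finite A" "\<And>s. s \<in> A \<Longrightarrow> f s \<in> carrier_mat k k"
  shows "mat_sum k f A \<in> carrier_mat k k"
proof -
  interpret abelian_group "module_mat TYPE(complex) k k" by (rule abelian_group_mat)
  have "f \<in> A \<rightarrow> carrier (module_mat TYPE(complex) k k)"
    using assms by (simp add: module_mat_simps)
  from finsum_closed[OF this] show ?thesis by (simp add: module_mat_simps)
qed

text \<open>Links the algebraic \<open>finsum\<close> of the matrix group to ordinary sums of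
  complex numbers, so that later identities can be checked entry by entry.\<close>

lemma mat_sum_index:
  assumes "finite A" "\<And>s. s \<in> A \<Longrightarrow> f s \<in> carrier_mat k k" "i < k" "j < k"
  shows "mat_sum k f A $$ (i, j) = (\<Sum>s\<in>A. f s $$ (i, j))"
  using assms(1,2)
proof (induction A)
  case empty
  interpret abelian_group "module_mat TYPE(complex) k k" by (rule abelian_group_mat)
  show ?case using assms(3,4) finsum_empty[of f] by (simp add: module_mat_simps)
next
  case (insert s A)
  interpret abelian_group "module_mat TYPE(complex) k k" by (rule abelian_group_mat)
  have *: "f \<in> A \<rightarrow> carrier (module_mat TYPE(complex) k k)"
    "f s \<in> carrier (module_mat TYPE(complex) k k)"
    using insert.prems by (auto simp: module_mat_simps)
  have "mat_sum k f (insert s A) = f s + mat_sum k f A"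
    using finsum_insert[OF insert.hyps *] by (simp add: module_mat_simps)
  moreover have "mat_sum k f A \<in> carrier_mat k k"
    using insert by (intro mat_sum_carrier) auto
  ultimately show ?case
    using insert assms(3,4) by simp
qed

lemma mat_trace_mult_mat_sum:
  assumes "M \<in> carrier_mat k k" "finite A" "\<And>s. s \<in> A \<Longrightarrow> f s \<in> carrier_mat k k"
  shows "mat_trace (M * mat_sum k f A) = (\<Sum>s\<in>A. mat_trace (M * f s))"
proof -
  have "mat_trace (M * mat_sum k f A) = (\<Sum>i<k. \<Sum>j<k. \<Sum>s\<in>A. M $$ (i, j) * f s $$ (j, i))"
    using assms
    by (simp add: mat_trace_mult[OF assms(1) mat_sum_carrier] mat_sum_index sum_distrib_left)
  also have "\<dots> = (\<Sum>s\<in>A. \<Sum>i<k. \<Sum>j<k. M $$ (i, j) * f s $$ (j, i))"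
    by (rule sum_swap3[symmetric])
  also have "\<dots> = (\<Sum>s\<in>A. mat_trace (M * f s))"
    using assms by (intro sum.cong refl) (simp add: mat_trace_mult[of _ k k])
  finally show ?thesis .
qed

lemma mat_trace_mult_smult:
  assumes "A \<in> carrier_mat k k" "B \<in> carrier_mat k k"
  shows "mat_trace (A * (c \<cdot>\<^sub>m B)) = c * mat_trace (A * B)"
  using assms by (simp add: mat_trace_mult[of _ k k] sum_distrib_left mult_ac)

lemma mat_trace_minus_mult:
  assumes "A \<in> carrier_mat k k" "B \<in> carrier_mat k k" "C \<in> carrier_mat k k"
  shows "mat_trace ((A - B) * C) = mat_trace (A * C) - mat_trace (B * C)"
proof -
  have "A - B \<in> carrier_mat k k" using assms by (intro minus_carrier_mat)
  then show ?thesis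
    using assms by (simp add: mat_trace_mult[of _ k k] sum_subtractf left_diff_distrib)
qed

section \<open>Projection onto an orthogonal family\<close>

text \<open>\<open>X\<close> is the Fourier expansion of \<open>M\<close> along \<open>B\<close>,
  whose members have squared length \<open>k\<close>. Pairing \<open>X\<close> with a member of
  \<open>B\<close> returns the coefficient of \<open>M\<close>, so the residual is orthogonal to
  \<open>B\<close>; pairing \<open>X\<close> with itself gives Parseval's identity.\<close>

lemma orthogonal_projection:
  fixes B :: "complex mat set" and k :: nat and M :: "complex mat"
  defines "X \<equiv> (1 / of_nat k) \<cdot>\<^sub>m mat_sum k (\<lambda>s. mat_trace (M * s) \<cdot>\<^sub>m s) B"
  assumes fin: "finite B" and k: "k > 0"
    and M: "M \<in> carrier_mat k k"
    and B: "\<And>s. s \<in> B \<Longrightarrow> s \<in> carrier_mat k k"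
    and real: "\<And>s. s \<in> B \<Longrightarrow> mat_trace (M * s) \<in> \<real>"
    and orth: "\<And>s t. s \<in> B \<Longrightarrow> t \<in> B \<Longrightarrow> mat_trace (s * t) = (if s = t then of_nat k else 0)"
  shows "is_projection_onto (real_span k B) M X"
    and "(\<Sum>s\<in>B. (mat_trace (M * s))\<^sup>2) = of_nat k * mat_trace (X * X)"
proof -
  have X: "X \<in> carrier_mat k k"
    unfolding X_def using fin B by (intro smult_carrier_mat mat_sum_carrier) auto
  have trX: "mat_trace (Y * X) = (\<Sum>s\<in>B. mat_trace (M * s) * mat_trace (Y * s)) / of_nat k"
    if "Y \<in> carrier_mat k k" for Y
    using that fin B
    by (simp add: X_def mat_trace_mult_smult[of _ k] mat_trace_mult_mat_sum mat_sum_carrier)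
  have trXB: "mat_trace (X * t) = mat_trace (M * t)" if t: "t \<in> B" for t
  proof -
    have "mat_trace (X * t) = (\<Sum>s\<in>B. mat_trace (M * s) * mat_trace (t * s)) / of_nat k"
      using mat_trace_comm[OF X B[OF t]] trX[OF B[OF t]] by simp
    \<comment> \<open>Orthogonality leaves only the summand \<open>s = t\<close>, whose factor
      \<open>k\<close> cancels the normalization of \<open>X\<close>.\<close>
    also have "(\<Sum>s\<in>B. mat_trace (M * s) * mat_trace (t * s))
        = (\<Sum>s\<in>B. if t = s then mat_trace (M * s) * of_nat k else 0)"
      using t by (intro sum.cong) (auto simp: orth)
    finally show ?thesis using t fin k by (simp add: sum.delta)
  qed
  \<comment> \<open>The span admits real coefficients only; all traces involved are real, so
    replacing each by its real part changes nothing.\<close>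
  have "X = mat_sum k (\<lambda>s. of_real (Re (mat_trace (M * s)) / of_nat k) \<cdot>\<^sub>m s) B" (is "_ = ?Y")
  proof (rule eq_matI)
    show "dim_row X = dim_row ?Y" "dim_col X = dim_col ?Y"
      using X mat_sum_carrier[of B "\<lambda>s. of_real (Re (mat_trace (M * s)) / of_nat k) \<cdot>\<^sub>m s" k] fin B
      by auto
    then have dim: "dim_row ?Y = k" "dim_col ?Y = k"
      using X by auto
    fix i j
    assume "i < dim_row ?Y" "j < dim_col ?Y"
    then have ij: "i < k" "j < k" using dim by auto
    have S: "mat_sum k (\<lambda>s. mat_trace (M * s) \<cdot>\<^sub>m s) B \<in> carrier_mat k k"
      using fin B by (intro mat_sum_carrier) auto
    have "X $$ (i, j) = (\<Sum>s\<in>B. mat_trace (M * s) * s $$ (i, j)) / of_nat k"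
    proof -
      have "(mat_sum k (\<lambda>s. mat_trace (M * s) \<cdot>\<^sub>m s) B) $$ (i, j)
          = (\<Sum>s\<in>B. mat_trace (M * s) * s $$ (i, j))"
        by (subst mat_sum_index) (use fin B ij in \<open>auto intro!: sum.cong dest: B\<close>)
      then show ?thesis using S ij by (simp add: X_def)
    qed
    also have "\<dots> = (\<Sum>s\<in>B. (of_real (Re (mat_trace (M * s)) / of_nat k) \<cdot>\<^sub>m s) $$ (i, j))"
      unfolding sum_divide_distrib
      by (intro sum.cong refl) (use B ij real in \<open>auto simp: of_real_Re dest!: B\<close>)
    also have "\<dots> = ?Y $$ (i, j)"
      using fin B ij by (subst mat_sum_index) auto
    finally show "X $$ (i, j) = ?Y $$ (i, j)" .
  qed
  then have "X \<in> real_span k B"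
    unfolding real_span_def by (intro CollectI exI conjI TrueI)
  moreover have "mat_trace ((M - X) * Y) = 0" if "Y \<in> real_span k B" for Y
  proof -
    from that obtain c :: "complex mat \<Rightarrow> real" where Y: "Y = mat_sum k (\<lambda>s. of_real (c s) \<cdot>\<^sub>m s) B"
      unfolding real_span_def by blast
    have MX: "M - X \<in> carrier_mat k k" using X by (intro minus_carrier_mat)
    have "mat_trace ((M - X) * Y) = (\<Sum>s\<in>B. of_real (c s) * mat_trace ((M - X) * s))"
      unfolding Y using MX fin B by (simp add: mat_trace_mult_mat_sum mat_trace_mult_smult[of _ k])
    also have "\<dots> = 0"
      using M X B trXB by (simp add: mat_trace_minus_mult[of _ k])
    finally show ?thesis .
  qed
  ultimately show "is_projection_onto (real_span k B) M X"
    unfolding is_projection_onto_def by blast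
  \<comment> \<open>\<open>trX\<close> at \<open>Y = X\<close> multiplies each coefficient by
    \<open>mat_trace (X * s)\<close>, which \<open>trXB\<close> turns into the same coefficient
    again.\<close>
  show "(\<Sum>s\<in>B. (mat_trace (M * s))\<^sup>2) = of_nat k * mat_trace (X * X)"
    using k trXB by (simp add: trX[OF X] power2_eq_square)
qed

section \<open>Tensor products\<close>

lemma kronecker_carrier:
  assumes "A \<in> carrier_mat m m" "B \<in> carrier_mat k k"
  shows "kronecker A B \<in> carrier_mat (m * k) (m * k)"
  using assms by (auto simp: kronecker_def)

lemma div_mod_less:
  fixes x :: nat
  assumes "x < m * k"
  shows "x div k < m" "x mod k < k"
  using assms by (auto simp: less_mult_imp_div_less intro!: mod_less_divisor gr0I)

lemma kronecker_index:
  assumes "A \<in> carrier_mat m m" "B \<in> carrier_mat k k" "x < m * k" "y < m * k"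
  shows "kronecker A B $$ (x, y) = A $$ (x div k, y div k) * B $$ (x mod k, y mod k)"
  using assms by (auto simp: kronecker_def)

text \<open>The contracted index splits into a quotient and a remainder that range independently, so
  the sum over it factors into the two local products.\<close>

lemma kronecker_mult:
  assumes A: "A \<in> carrier_mat m m" "B \<in> carrier_mat k k"
    and C: "C \<in> carrier_mat m m" "D \<in> carrier_mat k k"
  shows "kronecker A B * kronecker C D = kronecker (A * C) (B * D)"
proof (rule eq_matI)
  have AC: "A * C \<in> carrier_mat m m" and BD: "B * D \<in> carrier_mat k k"
    using assms by auto
  note car = kronecker_carrier[OF A] kronecker_carrier[OF C] kronecker_carrier[OF AC BD]
  show "dim_row (kronecker A B * kronecker C D) = dim_row (kronecker (A * C) (B * D))"
    "dim_col (kronecker A B * kronecker C D) = dim_col (kronecker (A * C) (B * D))"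
    using car by auto
  fix x y assume "x < dim_row (kronecker (A * C) (B * D))" "y < dim_col (kronecker (A * C) (B * D))"
  then have xy: "x < m * k" "y < m * k" using car by auto
  have "(kronecker A B * kronecker C D) $$ (x, y)
      = (\<Sum>z<m * k. (A $$ (x div k, z div k) * B $$ (x mod k, z mod k)) *
          (C $$ (z div k, y div k) * D $$ (z mod k, y mod k)))"
    unfolding index_mult_mat_sum[OF car(1,2) xy]
    using xy by (intro sum.cong refl) (simp add: kronecker_index[OF A] kronecker_index[OF C])
  also have "\<dots> = (\<Sum>i<m. \<Sum>j<k. (A $$ (x div k, i) * B $$ (x mod k, j)) *
          (C $$ (i, y div k) * D $$ (j, y mod k)))"
    by (rule sum_prod_div_mod)
  also have "\<dots> = (\<Sum>i<m. A $$ (x div k, i) * C $$ (i, y div k)) *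
      (\<Sum>j<k. B $$ (x mod k, j) * D $$ (j, y mod k))"
    by (simp add: sum_product mult_ac)
  also have "\<dots> = kronecker (A * C) (B * D) $$ (x, y)"
    unfolding kronecker_index[OF AC BD xy]
    using div_mod_less[OF xy(1)] div_mod_less[OF xy(2)]
    by (simp only: index_mult_mat_sum[OF A(1) C(1)] index_mult_mat_sum[OF A(2) C(2)])
  finally show "(kronecker A B * kronecker C D) $$ (x, y) = kronecker (A * C) (B * D) $$ (x, y)" .
qed

lemma kronecker_adjoint:
  assumes A: "A \<in> carrier_mat m m" "B \<in> carrier_mat k k"
  shows "mat_adjoint (kronecker A B) = kronecker (mat_adjoint A) (mat_adjoint B)"
proof (rule eq_matI)
  note adj = mat_adjoint_carrier[OF A(1)] mat_adjoint_carrier[OF A(2)]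
  note car = mat_adjoint_carrier[OF kronecker_carrier[OF A]] kronecker_carrier[OF adj]
  show "dim_row (mat_adjoint (kronecker A B)) = dim_row (kronecker (mat_adjoint A) (mat_adjoint B))"
    "dim_col (mat_adjoint (kronecker A B)) = dim_col (kronecker (mat_adjoint A) (mat_adjoint B))"
    using car by auto
  fix x y
  assume "x < dim_row (kronecker (mat_adjoint A) (mat_adjoint B))"
    "y < dim_col (kronecker (mat_adjoint A) (mat_adjoint B))"
  then have xy: "x < m * k" "y < m * k" using car by auto
  show "mat_adjoint (kronecker A B) $$ (x, y) = kronecker (mat_adjoint A) (mat_adjoint B) $$ (x, y)"
    unfolding mat_adjoint_index[OF kronecker_carrier[OF A] xy] kronecker_index[OF adj xy]
      kronecker_index[OF A xy(2,1)]
    using div_mod_less[OF xy(1)] div_mod_less[OF xy(2)]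
    by (simp add: mat_adjoint_index[OF A(1)] mat_adjoint_index[OF A(2)])
qed

text \<open>Diagonal positions correspond to pairs of local diagonal positions, so the sum
  factors.\<close>

lemma kronecker_trace:
  assumes A: "A \<in> carrier_mat m m" "B \<in> carrier_mat k k"
  shows "mat_trace (kronecker A B) = mat_trace A * mat_trace B"
proof -
  have "mat_trace (kronecker A B)
      = (\<Sum>x<m * k. A $$ (x div k, x div k) * B $$ (x mod k, x mod k))"
    using kronecker_carrier[OF A] by (simp add: mat_trace_def kronecker_index[OF A])
  also have "\<dots> = (\<Sum>i<m. \<Sum>j<k. A $$ (i, i) * B $$ (j, j))"
    by (rule sum_prod_div_mod)
  also have "\<dots> = mat_trace A * mat_trace B"
    using A by (simp add: mat_trace_def sum_product)
  finally show ?thesis .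
qed

lemma total_dim_Suc: "total_dim (Suc n) d = total_dim n d * d (Suc n)"
  by (simp add: total_dim_def prod.nat_ivl_Suc' mult.commute)

lemma tensor_carrier:
  assumes "\<And>a. a \<in> {1..n} \<Longrightarrow> A a \<in> carrier_mat (d a) (d a)"
  shows "tensor n A \<in> carrier_mat (total_dim n d) (total_dim n d)"
  using assms
proof (induction n)
  case (Suc n)
  then show ?case by (auto simp: total_dim_Suc intro!: kronecker_carrier)
qed (simp add: total_dim_def)

lemma tensor_cong:
  assumes "\<And>a. a \<in> {1..n} \<Longrightarrow> A a = B a"
  shows "tensor n A = tensor n B"
  using assms by (induction n) auto

lemma tensor_mult:
  assumes "\<And>a. a \<in> {1..n} \<Longrightarrow> A a \<in> carrier_mat (d a) (d a)"
    and "\<And>a. a \<in> {1..n} \<Longrightarrow> B a \<in> carrier_mat (d a) (d a)"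
  shows "tensor n A * tensor n B = tensor n (\<lambda>a. A a * B a)"
  using assms
proof (induction n)
  case (Suc n)
  have "tensor (Suc n) A * tensor (Suc n) B
      = kronecker (tensor n A * tensor n B) (A (Suc n) * B (Suc n))"
    using Suc.prems by (auto intro!: kronecker_mult[where m = "total_dim n d" and k = "d (Suc n)"] tensor_carrier)
  then show ?case using Suc by simp
qed simp

lemma tensor_adjoint:
  assumes "\<And>a. a \<in> {1..n} \<Longrightarrow> A a \<in> carrier_mat (d a) (d a)"
  shows "mat_adjoint (tensor n A) = tensor n (\<lambda>a. mat_adjoint (A a))"
  using assms
proof (induction n)
  case 0
  have "mat_adjoint (1\<^sub>m 1) = (1\<^sub>m 1 :: complex mat)"
    by (rule eq_matI)
      (use mat_adjoint_carrier[of "1\<^sub>m 1 :: complex mat" 1 1] in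
        \<open>auto simp: mat_adjoint_index[of _ 1 1]\<close>)
  then show ?case by simp
next
  case (Suc n)
  have "mat_adjoint (tensor (Suc n) A) = kronecker (mat_adjoint (tensor n A)) (mat_adjoint (A (Suc n)))"
    using Suc.prems by (auto intro!: kronecker_adjoint[where m = "total_dim n d" and k = "d (Suc n)"] tensor_carrier)
  then show ?case using Suc by simp
qed

lemma tensor_trace:
  assumes "\<And>a. a \<in> {1..n} \<Longrightarrow> A a \<in> carrier_mat (d a) (d a)"
  shows "mat_trace (tensor n A) = (\<Prod>a\<in>{1..n}. mat_trace (A a))"
  using assms
proof (induction n)
  case 0
  then show ?case by (simp add: mat_trace_def)
next
  case (Suc n)
  have "mat_trace (tensor (Suc n) A) = mat_trace (tensor n A) * mat_trace (A (Suc n))"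
    using Suc.prems by (auto intro!: kronecker_trace[where m = "total_dim n d" and k = "d (Suc n)"] tensor_carrier)
  then show ?case using Suc by (simp add: prod.nat_ivl_Suc' mult.commute)
qed

text \<open>Mixed-radix digits: a row index of \<open>tensor n A\<close> encodes one row index per party, party \<open>n\<close>
  being the least significant digit.\<close>

fun digit :: "(nat \<Rightarrow> nat) \<Rightarrow> nat \<Rightarrow> nat \<Rightarrow> nat \<Rightarrow> nat" where
  "digit d 0 a x = 0"
| "digit d (Suc n) a x = (if a = Suc n then x mod d (Suc n) else digit d n a (x div d (Suc n)))"

lemma digit_less:
  assumes "x < total_dim n d" "a \<in> {1..n}"
  shows "digit d n a x < d a"
  using assms
proof (induction n arbitrary: x)
  case (Suc n)
  then show ?case
    using div_mod_less[of x "total_dim n d" "d (Suc n)"] by (auto simp: total_dim_Suc)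
qed simp

text \<open>Each Kronecker step peels off the least significant digit. The product form of the
  entries reduces multilinearity to distributing a product over sums.\<close>

lemma tensor_index:
  assumes "\<And>a. a \<in> {1..n} \<Longrightarrow> A a \<in> carrier_mat (d a) (d a)"
    and "x < total_dim n d" "y < total_dim n d"
  shows "tensor n A $$ (x, y) = (\<Prod>a\<in>{1..n}. A a $$ (digit d n a x, digit d n a y))"
  using assms
proof (induction n arbitrary: x y)
  case 0
  then show ?case by (simp add: total_dim_def)
next
  case (Suc n)
  let ?k = "d (Suc n)"
  have xy: "x < total_dim n d * ?k" "y < total_dim n d * ?k"
    using Suc.prems by (auto simp: total_dim_Suc)
  note less = div_mod_less[OF xy(1)] div_mod_less[OF xy(2)]
  have T: "tensor n A \<in> carrier_mat (total_dim n d) (total_dim n d)"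
    using Suc.prems by (auto intro!: tensor_carrier)
  have "tensor (Suc n) A $$ (x, y)
      = tensor n A $$ (x div ?k, y div ?k) * A (Suc n) $$ (x mod ?k, y mod ?k)"
    using kronecker_index[OF T _ xy] Suc.prems by simp
  also have "tensor n A $$ (x div ?k, y div ?k)
      = (\<Prod>a\<in>{1..n}. A a $$ (digit d n a (x div ?k), digit d n a (y div ?k)))"
    using Suc.prems less by (intro Suc.IH) auto
  also have "\<dots> = (\<Prod>a\<in>{1..n}. A a $$ (digit d (Suc n) a x, digit d (Suc n) a y))"
    by (intro prod.cong) auto
  finally show ?case
    by (simp add: prod.nat_ivl_Suc' mult.commute)
qed

text \<open>Multilinearity of the tensor product, tested against \<open>M\<close>: expanding every
  factor yields one term for each choice \<open>j\<close> of a summand at every party.\<close>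

lemma mat_trace_mult_tensor_expand:
  assumes M: "M \<in> carrier_mat (total_dim n d) (total_dim n d)"
    and A: "\<And>a. a \<in> {1..n} \<Longrightarrow> A a \<in> carrier_mat (d a) (d a)"
    and \<tau>: "\<And>a j. a \<in> {1..n} \<Longrightarrow> j \<in> J a \<Longrightarrow> \<tau> a j \<in> carrier_mat (d a) (d a)"
    and J: "\<And>a. a \<in> {1..n} \<Longrightarrow> finite (J a)"
    and expand: "\<And>a p q. a \<in> {1..n} \<Longrightarrow> p < d a \<Longrightarrow> q < d a \<Longrightarrow>
        A a $$ (p, q) = (\<Sum>j\<in>J a. c a j * \<tau> a j $$ (p, q))"
  shows "mat_trace (M * tensor n A) =
    (\<Sum>j\<in>Pi\<^sub>E {1..n} J. (\<Prod>a\<in>{1..n}. c a (j a)) * mat_trace (M * tensor n (\<lambda>a. \<tau> a (j a))))"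
proof -
  let ?D = "total_dim n d"
  have T: "tensor n (\<lambda>a. \<tau> a (j a)) \<in> carrier_mat ?D ?D" if "j \<in> Pi\<^sub>E {1..n} J" for j
    using that \<tau> by (intro tensor_carrier) (auto simp: PiE_iff)
  have entry: "tensor n A $$ (x, y) =
      (\<Sum>j\<in>Pi\<^sub>E {1..n} J. (\<Prod>a\<in>{1..n}. c a (j a)) * tensor n (\<lambda>a. \<tau> a (j a)) $$ (x, y))"
    if xy: "x < ?D" "y < ?D" for x y
  proof -
    have "tensor n A $$ (x, y) =
        (\<Prod>a\<in>{1..n}. \<Sum>j\<in>J a. c a j * \<tau> a j $$ (digit d n a x, digit d n a y))"
      by (subst tensor_index[OF A xy])
        (use xy digit_less in \<open>auto intro!: prod.cong expand\<close>)
    \<comment> \<open>The product is distributed over the local sums; extensionality ensures that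
      each choice is counted once.\<close>
    also have "\<dots> = (\<Sum>j\<in>Pi\<^sub>E {1..n} J.
        \<Prod>a\<in>{1..n}. c a (j a) * \<tau> a (j a) $$ (digit d n a x, digit d n a y))"
      using J by (intro prod_sum_PiE) auto
    also have "\<dots> = (\<Sum>j\<in>Pi\<^sub>E {1..n} J.
        (\<Prod>a\<in>{1..n}. c a (j a)) * tensor n (\<lambda>a. \<tau> a (j a)) $$ (x, y))"
      by (intro sum.cong refl, subst tensor_index)
        (use \<tau> xy in \<open>auto simp: PiE_iff prod.distrib\<close>)
    finally show ?thesis .
  qed
  have "mat_trace (M * tensor n A) = (\<Sum>x<?D. \<Sum>y<?D. \<Sum>j\<in>Pi\<^sub>E {1..n} J.
      (\<Prod>a\<in>{1..n}. c a (j a)) * (M $$ (x, y) * tensor n (\<lambda>a. \<tau> a (j a)) $$ (y, x)))"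
    by (subst mat_trace_mult[OF M tensor_carrier[OF A]])
      (auto simp: entry sum_distrib_left mult_ac intro!: sum.cong)
  also have "\<dots> = (\<Sum>j\<in>Pi\<^sub>E {1..n} J. \<Sum>x<?D. \<Sum>y<?D.
      (\<Prod>a\<in>{1..n}. c a (j a)) * (M $$ (x, y) * tensor n (\<lambda>a. \<tau> a (j a)) $$ (y, x)))"
    by (rule sum_swap3[symmetric])
  also have "\<dots> = (\<Sum>j\<in>Pi\<^sub>E {1..n} J.
      (\<Prod>a\<in>{1..n}. c a (j a)) * mat_trace (M * tensor n (\<lambda>a. \<tau> a (j a))))"
    by (intro sum.cong refl) (simp add: mat_trace_mult[OF M T] sum_distrib_left)
  finally show ?thesis .
qed

section \<open>Local operator bases\<close>

lemma local_operator_basisD: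
  assumes "local_operator_basis k s"
  shows "s 0 = 1\<^sub>m k"
    and "i < k\<^sup>2 \<Longrightarrow> s i \<in> carrier_mat k k"
    and "i < k\<^sup>2 \<Longrightarrow> hermitian_mat (s i)"
    and "i < k\<^sup>2 \<Longrightarrow> j < k\<^sup>2 \<Longrightarrow> mat_trace (s i * s j) = (if i = j then of_nat k else 0)"
  using assms by (auto simp: local_operator_basis_def)

text \<open>Orthogonality says that the square matrix with rows \<open>s i\<close> has a right inverse; completeness says
  that this is also a left inverse.\<close>

lemma local_completeness:
  assumes "local_operator_basis k s" and k: "k > 0"
    and less: "p < k" "q < k" "r < k" "t < k"
  shows "(\<Sum>i<k\<^sup>2. s i $$ (q, p) * s i $$ (r, t)) = (if p = r \<and> q = t then of_nat k else 0)"
proof -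
  note B = local_operator_basisD[OF assms(1)]
  let ?K = "k\<^sup>2"
  \<comment> \<open>Column \<open>x\<close> of \<open>M\<close> stands for the matrix position
    \<open>(x div k, x mod k)\<close>. In \<open>N\<close> the position is transposed and the entry
    scaled, so that entry \<open>(i, j)\<close> of \<open>M * N\<close> is
    \<open>mat_trace (s i * s j) / of_nat k\<close>.\<close>
  define M where "M = mat ?K ?K (\<lambda>(i, x). s i $$ (x div k, x mod k))"
  define N where "N = mat ?K ?K (\<lambda>(x, j). s j $$ (x mod k, x div k) / of_nat k)"
  have M: "M \<in> carrier_mat ?K ?K" and N: "N \<in> carrier_mat ?K ?K"
    by (auto simp: M_def N_def)
  have "M * N = 1\<^sub>m ?K"
  proof (rule eq_matI)
    fix i j assume "i < dim_row (1\<^sub>m ?K :: complex mat)" "j < dim_col (1\<^sub>m ?K :: complex mat)"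
    then have ij: "i < ?K" "j < ?K" by auto
    have "(M * N) $$ (i, j)
        = (\<Sum>x<k * k. s i $$ (x div k, x mod k) * (s j $$ (x mod k, x div k) / of_nat k))"
      unfolding index_mult_mat_sum[OF M N ij]
      using ij by (intro sum.cong) (auto simp: M_def N_def power2_eq_square)
    also have "\<dots> = (\<Sum>x<k. \<Sum>y<k. s i $$ (x, y) * (s j $$ (y, x) / of_nat k))"
      by (rule sum_prod_div_mod)
    also have "\<dots> = mat_trace (s i * s j) / of_nat k"
      by (simp add: mat_trace_mult[OF B(2)[OF ij(1)] B(2)[OF ij(2)]] sum_divide_distrib)
    finally show "(M * N) $$ (i, j) = 1\<^sub>m ?K $$ (i, j)"
      using ij k by (simp add: B(4))
  qed (use M N in auto)
  \<comment> \<open>Squareness enters here: the number of operators equals the number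
    \<open>k\<^sup>2\<close> of matrix positions.\<close>
  from mat_mult_left_right_inverse[OF M N this] have NM: "N * M = 1\<^sub>m ?K" .
  have less_sq: "x * k + y < ?K" if "x < k" "y < k" for x y
  proof -
    have "x * k + y < Suc x * k" using that by simp
    also have "\<dots> \<le> k * k" using that by (intro mult_le_mono1) simp
    finally show ?thesis by (simp add: power2_eq_square)
  qed
  have xy: "p * k + q < ?K" "r * k + t < ?K"
    using less by (auto intro: less_sq)
  have inj: "p * k + q = r * k + t \<longleftrightarrow> p = r \<and> q = t"
  proof
    assume "p * k + q = r * k + t"
    then have "(p * k + q) div k = (r * k + t) div k" "(p * k + q) mod k = (r * k + t) mod k"
      by simp_all
    then show "p = r \<and> q = t" using less by simp
  qed simp
  \<comment> \<open>\<open>N * M\<close> is read off at the codes of \<open>(p, q)\<close> and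
    \<open>(r, t)\<close>; the transposition in \<open>N\<close> produces the entry
    \<open>(q, p)\<close>.\<close>
  have "(\<Sum>i<?K. s i $$ (q, p) / of_nat k * s i $$ (r, t)) = (N * M) $$ (p * k + q, r * k + t)"
    unfolding index_mult_mat_sum[OF N M xy]
    by (intro sum.cong refl) (use xy less in \<open>auto simp: M_def N_def\<close>)
  also have "\<dots> = (if p = r \<and> q = t then 1 else 0)"
    using xy by (simp add: NM inj)
  finally show ?thesis
    using k by (simp add: sum_divide_distrib[symmetric] divide_simps split: if_splits)
qed

text \<open>With the trace written out and the sum over \<open>i\<close> performed first,
  completeness leaves only the entry \<open>(r, t)\<close> of \<open>A\<close>.\<close>

lemma local_expansion:
  assumes "local_operator_basis k s" and k: "k > 0"
    and A: "A \<in> carrier_mat k k" and less: "r < k" "t < k"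
  shows "A $$ (r, t) = (\<Sum>i<k\<^sup>2. mat_trace (A * s i) / of_nat k * s i $$ (r, t))"
proof -
  note B = local_operator_basisD[OF assms(1)]
  have "(\<Sum>i<k\<^sup>2. mat_trace (A * s i) * s i $$ (r, t))
      = (\<Sum>i<k\<^sup>2. \<Sum>p<k. \<Sum>q<k. A $$ (p, q) * (s i $$ (q, p) * s i $$ (r, t)))"
    by (intro sum.cong refl) (simp add: mat_trace_mult[OF A B(2)] sum_distrib_right mult.assoc)
  also have "\<dots> = (\<Sum>p<k. \<Sum>q<k. \<Sum>i<k\<^sup>2. A $$ (p, q) * (s i $$ (q, p) * s i $$ (r, t)))"
    by (rule sum_swap3)
  also have "\<dots> = (\<Sum>p<k. \<Sum>q<k. A $$ (p, q) * (if p = r \<and> q = t then of_nat k else 0))"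
    by (intro sum.cong refl)
      (simp add: sum_distrib_left[symmetric] local_completeness[OF assms(1) k] less)
  also have "\<dots> = (\<Sum>p<k. if p = r then \<Sum>q<k. if q = t then A $$ (p, q) * of_nat k else 0 else 0)"
    by (intro sum.cong refl) (simp add: if_distrib[of "(*) _"] cong: if_cong)
  also have "\<dots> = A $$ (r, t) * of_nat k"
    using less by (simp only: sum.delta finite_lessThan lessThan_iff if_True)
  finally show ?thesis
    using k by (simp add: sum_divide_distrib[symmetric])
qed

text \<open>Expanding \<open>A\<close> in the basis and exchanging sum and trace leaves the
  coefficients of \<open>C\<close>. The pairing is bilinear, without conjugation.\<close>

lemma local_parseval:
  assumes "local_operator_basis k s" and k: "k > 0"
    and A: "A \<in> carrier_mat k k" and C: "C \<in> carrier_mat k k"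
  shows "(\<Sum>i<k\<^sup>2. mat_trace (A * s i) * mat_trace (C * s i)) = of_nat k * mat_trace (A * C)"
proof -
  note B = local_operator_basisD[OF assms(1)]
  have "mat_trace (A * C)
      = (\<Sum>p<k. \<Sum>q<k. \<Sum>i<k\<^sup>2. mat_trace (A * s i) / of_nat k * (C $$ (q, p) * s i $$ (p, q)))"
    unfolding mat_trace_mult[OF A C]
  proof (intro sum.cong refl)
    fix p q assume "p \<in> {..<k}" "q \<in> {..<k}"
    then show "A $$ (p, q) * C $$ (q, p)
      = (\<Sum>i<k\<^sup>2. mat_trace (A * s i) / of_nat k * (C $$ (q, p) * s i $$ (p, q)))"
      by (subst local_expansion[OF assms(1) k A]) (auto simp: sum_distrib_left mult_ac)
  qed
  also have "\<dots> = (\<Sum>i<k\<^sup>2. \<Sum>q<k. \<Sum>p<k.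
      mat_trace (A * s i) / of_nat k * (C $$ (q, p) * s i $$ (p, q)))"
    by (subst sum.swap) (rule sum_swap3[symmetric])
  also have "\<dots> = (\<Sum>i<k\<^sup>2. mat_trace (A * s i) / of_nat k * mat_trace (C * s i))"
    by (intro sum.cong refl) (simp add: mat_trace_mult[OF C B(2)] sum_distrib_left)
  finally show ?thesis
    using k by (simp add: sum_divide_distrib[symmetric])
qed

section \<open>Conjugation by a local unitary in operator coordinates\<close>

lemma unitary_matD:
  assumes "unitary_mat k U"
  shows "U \<in> carrier_mat k k" "mat_adjoint U \<in> carrier_mat k k"
    "U * mat_adjoint U = 1\<^sub>m k" "mat_adjoint U * U = 1\<^sub>m k"
  using assms mat_adjoint_carrier[of U k k] by (auto simp: unitary_mat_def)

text \<open>For mutually adjoint \<open>V\<close> and \<open>W\<close>, cyclicity of the trace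
  trades a conjugation of \<open>A\<close> for the opposite conjugation of \<open>C\<close>.\<close>

lemma mat_trace_conjugate:
  assumes "A \<in> carrier_mat k k" "V \<in> carrier_mat k k" "W \<in> carrier_mat k k" "C \<in> carrier_mat k k"
  shows "mat_trace (V * A * W * C) = mat_trace (A * (W * C * V))"
proof -
  have "mat_trace (V * A * W * C) = mat_trace (V * (A * (W * C)))"
    using assms by (simp add: assoc_mult_mat[of _ k k _ k _ k])
  also have "\<dots> = mat_trace (A * (W * C) * V)"
    using assms by (intro mat_trace_comm[of _ k k]) auto
  also have "\<dots> = mat_trace (A * (W * C * V))"
    using assms by (simp add: assoc_mult_mat[of _ k k _ k _ k])
  finally show ?thesis .
qed

text \<open>The matrix of \<open>X \<mapsto> U\<^sup>\<dagger> X U\<close> in the basis \<open>s\<close>.\<close>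

definition conj_coeff :: "nat \<Rightarrow> (nat \<Rightarrow> complex mat) \<Rightarrow> complex mat \<Rightarrow> nat \<Rightarrow> nat \<Rightarrow> complex" where
  "conj_coeff k s U i j = mat_trace (mat_adjoint U * s i * U * s j) / of_nat k"

text \<open>Parseval turns the sum over \<open>i\<close> into the trace pairing of
  \<open>U * s j * mat_adjoint U\<close> with \<open>U * s l * mat_adjoint U\<close>, and
  conjugation by a unitary preserves that pairing.\<close>

lemma conj_coeff_orthogonal:
  assumes s: "local_operator_basis k s" and k: "k > 0" and U: "unitary_mat k U"
    and jl: "j < k\<^sup>2" "l < k\<^sup>2"
  shows "(\<Sum>i<k\<^sup>2. conj_coeff k s U i j * conj_coeff k s U i l) = (if j = l then 1 else 0)"
proof -
  note B = local_operator_basisD[OF s] and U' = unitary_matD[OF U]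
  let ?C = "\<lambda>j. U * s j * mat_adjoint U"
  have C: "?C j \<in> carrier_mat k k" if "j < k\<^sup>2" for j
    using B(2)[OF that] U' by auto
  \<comment> \<open>Moving the conjugation onto \<open>s j\<close> leaves the bare
    \<open>s i\<close> as second factor, the form to which Parseval applies.\<close>
  have coeff: "conj_coeff k s U i j = mat_trace (?C j * s i) / of_nat k"
    if "i < k\<^sup>2" "j < k\<^sup>2" for i j
    using mat_trace_conjugate[OF B(2)[OF that(1)] U'(2,1) B(2)[OF that(2)]]
      mat_trace_comm[OF B(2)[OF that(1)] C[OF that(2)]]
    by (simp add: conj_coeff_def)
  have "mat_trace (?C j * ?C l) = mat_trace (s j * (mat_adjoint U * ?C l * U))"
    by (rule mat_trace_conjugate[OF B(2)[OF jl(1)] U'(1,2) C[OF jl(2)]])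
  also have "mat_adjoint U * ?C l * U = (mat_adjoint U * U) * s l * (mat_adjoint U * U)"
    using U'(1,2) B(2)[OF jl(2)] by (simp add: assoc_mult_mat[of _ k k _ k _ k])
  also have "\<dots> = s l"
    using B(2)[OF jl(2)] by (simp add: U')
  finally have "mat_trace (?C j * ?C l) = (if j = l then of_nat k else 0)"
    using jl by (simp add: B(4))
  moreover have "(\<Sum>i<k\<^sup>2. conj_coeff k s U i j * conj_coeff k s U i l)
      = (\<Sum>i<k\<^sup>2. mat_trace (?C j * s i) * mat_trace (?C l * s i)) / (of_nat k * of_nat k)"
    unfolding sum_divide_distrib using jl by (intro sum.cong refl) (simp add: coeff)
  \<comment> \<open>Parseval contributes one factor \<open>k\<close> and, for \<open>j = l\<close>,
    orthogonality another; together they cancel the denominator.\<close>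
  ultimately show ?thesis
    using k by (simp add: local_parseval[OF s k C[OF jl(1)] C[OF jl(2)]])
qed

text \<open>Conjugation fixes the identity and preserves the traceless operators.\<close>

lemma conj_coeff_block:
  assumes s: "local_operator_basis k s" and k: "k > 0" and U: "unitary_mat k U"
    and ij: "i < k\<^sup>2" "j < k\<^sup>2" and neq: "(i = 0) \<noteq> (j = 0)"
  shows "conj_coeff k s U i j = 0"
proof -
  note B = local_operator_basisD[OF s] and U' = unitary_matD[OF U]
  \<comment> \<open>Tracelessness is orthogonality to \<open>s 0\<close>, the identity.\<close>
  have tr0: "mat_trace (s l) = 0" if "l < k\<^sup>2" "l \<noteq> 0" for l
    using B(4)[OF that(1), of 0] that k B(2)[OF that(1)] by (simp add: B(1))
  show ?thesis
  proof (cases "i = 0")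
    case True
    \<comment> \<open>The conjugate of the identity is the identity, so the coefficient is a
      multiple of the trace of \<open>s j\<close>.\<close>
    then show ?thesis
      using neq ij U' B(2)[OF ij(2)] tr0[OF ij(2)] by (simp add: conj_coeff_def B(1))
  next
    case False
    \<comment> \<open>Here \<open>j = 0\<close>. Cyclicity lets the unitary and its adjoint cancel
      around the identity, which leaves the trace of \<open>s i\<close>.\<close>
    then have "conj_coeff k s U i j = mat_trace (s i * (U * 1\<^sub>m k * mat_adjoint U)) / of_nat k"
      using neq mat_trace_conjugate[OF B(2)[OF ij(1)] U'(2,1), of "1\<^sub>m k"]
      by (simp add: conj_coeff_def B(1))
    then show ?thesis
      using False U' B(2)[OF ij(1)] tr0[OF ij(1)] by simp
  qed
qed

section \<open>Correlation operators\<close>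

lemma total_dim_pos_iff: "total_dim n d > 0 \<longleftrightarrow> (\<forall>a\<in>{1..n}. d a > 0)"
  by (auto simp: total_dim_def prod_zero_iff intro!: Nat.gr0I)

text \<open>The trace of a product of tensors factors over the parties, and a single party with
  differing indices already contributes a zero factor.\<close>

lemma tensor_basis_orthogonal:
  assumes s: "\<And>a. a \<in> {1..n} \<Longrightarrow> local_operator_basis (d a) (\<sigma> a)"
    and i: "i \<in> (\<Pi>\<^sub>E a\<in>{1..n}. {..<(d a)\<^sup>2})" and j: "j \<in> (\<Pi>\<^sub>E a\<in>{1..n}. {..<(d a)\<^sup>2})"
  shows "mat_trace (tensor n (\<lambda>a. \<sigma> a (i a)) * tensor n (\<lambda>a. \<sigma> a (j a)))
    = (if i = j then of_nat (total_dim n d) else 0)"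
proof -
  have lt: "i a < (d a)\<^sup>2" "j a < (d a)\<^sup>2" if "a \<in> {1..n}" for a
    using i j that by (auto simp: PiE_iff)
  have car: "\<sigma> a (i a) \<in> carrier_mat (d a) (d a)" "\<sigma> a (j a) \<in> carrier_mat (d a) (d a)"
    if "a \<in> {1..n}" for a
    using local_operator_basisD(2)[OF s[OF that]] lt[OF that] by auto
  have "mat_trace (tensor n (\<lambda>a. \<sigma> a (i a)) * tensor n (\<lambda>a. \<sigma> a (j a)))
      = mat_trace (tensor n (\<lambda>a. \<sigma> a (i a) * \<sigma> a (j a)))"
    using car by (subst tensor_mult[where d = d]) auto
  also have "\<dots> = (\<Prod>a\<in>{1..n}. mat_trace (\<sigma> a (i a) * \<sigma> a (j a)))"
    using car by (intro tensor_trace[where d = d] mult_carrier_mat) auto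
  also have "\<dots> = (\<Prod>a\<in>{1..n}. if i a = j a then of_nat (d a) else 0)"
    using lt by (intro prod.cong refl local_operator_basisD(4)[OF s]) auto
  also have "\<dots> = (if i = j then of_nat (total_dim n d) else 0)"
  proof (cases "i = j")
    case False
    \<comment> \<open>Distinct extensional functions must differ at some party in
      \<open>{1..n}\<close>.\<close>
    then obtain a where "a \<in> {1..n}" "i a \<noteq> j a"
      using PiE_ext[OF i j] by blast
    then have "(\<Prod>a\<in>{1..n}. if i a = j a then of_nat (d a) else (0 :: complex)) = 0"
      by (intro prod_zero) auto
    then show ?thesis using False by simp
  qed (simp add: total_dim_def)
  finally show ?thesis .
qed

text \<open>Index functions stand in for the operators, so that sums over operators become sums over
  functions and coefficients can be treated party by party.\<close>

definition correlation_indices :: "nat \<Rightarrow> (nat \<Rightarrow> nat) \<Rightarrow> nat set \<Rightarrow> (nat \<Rightarrow> nat) set" where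
  "correlation_indices n d S =
     {i \<in> (\<Pi>\<^sub>E a\<in>{1..n}. {..<(d a)\<^sup>2}). {a\<in>{1..n}. i a \<noteq> 0} = S}"

lemma finite_correlation_indices: "finite (correlation_indices n d S)"
  unfolding correlation_indices_def by (intro finite_Collect_conjI disjI1) (simp add: finite_PiE)

lemma correlation_operators_eq_image:
  "correlation_operators n d \<sigma> S = (\<lambda>i. tensor n (\<lambda>a. \<sigma> a (i a))) ` correlation_indices n d S"
  by (auto simp: correlation_operators_def correlation_indices_def)

text \<open>Distinct indices with the same operator would give one trace pairing both the value 0
  and the positive value \<open>total_dim n d\<close>.\<close>

lemma inj_on_tensor_basis:
  assumes "\<And>a. a \<in> {1..n} \<Longrightarrow> local_operator_basis (d a) (\<sigma> a)" "total_dim n d > 0"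
  shows "inj_on (\<lambda>i. tensor n (\<lambda>a. \<sigma> a (i a))) (\<Pi>\<^sub>E a\<in>{1..n}. {..<(d a)\<^sup>2})"
proof (rule inj_onI)
  fix i j
  assume ij: "i \<in> (\<Pi>\<^sub>E a\<in>{1..n}. {..<(d a)\<^sup>2})" "j \<in> (\<Pi>\<^sub>E a\<in>{1..n}. {..<(d a)\<^sup>2})"
    and eq: "tensor n (\<lambda>a. \<sigma> a (i a)) = tensor n (\<lambda>a. \<sigma> a (j a))"
  show "i = j"
  proof (rule ccontr)
    assume "i \<noteq> j"
    then show False
      using tensor_basis_orthogonal[OF assms(1) ij] tensor_basis_orthogonal[OF assms(1) ij(1) ij(1)]
        eq assms(2) by simp
  qed
qed

lemma tensor_basis_carrier:
  assumes "\<And>a. a \<in> {1..n} \<Longrightarrow> local_operator_basis (d a) (\<sigma> a)"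
    and "i \<in> (\<Pi>\<^sub>E a\<in>{1..n}. {..<(d a)\<^sup>2})"
  shows "tensor n (\<lambda>a. \<sigma> a (i a)) \<in> carrier_mat (total_dim n d) (total_dim n d)"
  using assms(2) by (intro tensor_carrier local_operator_basisD(2) assms(1)) (auto simp: PiE_iff)

lemma tensor_basis_hermitian:
  assumes "\<And>a. a \<in> {1..n} \<Longrightarrow> local_operator_basis (d a) (\<sigma> a)"
    and "i \<in> (\<Pi>\<^sub>E a\<in>{1..n}. {..<(d a)\<^sup>2})"
  shows "hermitian_mat (tensor n (\<lambda>a. \<sigma> a (i a)))"
proof -
  have lt: "i a < (d a)\<^sup>2" if "a \<in> {1..n}" for a
    using assms(2) that by (auto simp: PiE_iff)
  have "mat_adjoint (tensor n (\<lambda>a. \<sigma> a (i a))) = tensor n (\<lambda>a. mat_adjoint (\<sigma> a (i a)))"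
    using lt by (intro tensor_adjoint[where d = d] local_operator_basisD(2) assms(1)) auto
  also have "\<dots> = tensor n (\<lambda>a. \<sigma> a (i a))"
    using local_operator_basisD(3)[OF assms(1)] lt
    by (intro tensor_cong) (auto simp: hermitian_mat_def)
  finally show ?thesis by (simp add: hermitian_mat_def)
qed

section \<open>Invariance of the correlation strength under local unitaries\<close>

lemma correlation_strength_local_unitary:
  assumes s: "\<And>a. a \<in> {1..n} \<Longrightarrow> local_operator_basis (d a) (\<sigma> a)"
    and D: "total_dim n d > 0"
    and \<rho>: "\<rho> \<in> carrier_mat (total_dim n d) (total_dim n d)"
    and U: "\<And>a. a \<in> {1..n} \<Longrightarrow> unitary_mat (d a) (U a)"
  shows "correlation_strength n d \<sigma> S (tensor n U * \<rho> * mat_adjoint (tensor n U))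
    = correlation_strength n d \<sigma> S \<rho>"
proof -
  let ?P = "\<Pi>\<^sub>E a\<in>{1..n}. {..<(d a)\<^sup>2}"
  let ?I = "correlation_indices n d S"
  let ?D = "total_dim n d"
  let ?T = "\<lambda>i. tensor n (\<lambda>a. \<sigma> a (i a))"
  define t where "t = (\<lambda>i. mat_trace (\<rho> * ?T i))"
  define c where "c = (\<lambda>a. conj_coeff (d a) (\<sigma> a) (U a))"
  \<comment> \<open>This is the matrix of conjugation by the whole tensor product in the product
    basis; its entries are products of local coefficients.\<close>
  define R where "R = (\<lambda>i j. \<Prod>a\<in>{1..n}. c a (i a) (j a))"
  have d: "d a > 0" if "a \<in> {1..n}" for a
    using D that by (simp add: total_dim_pos_iff)
  have I: "?I \<subseteq> ?P" by (auto simp: correlation_indices_def)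
  have finP: "finite ?P" by (simp add: finite_PiE)
  note U' = unitary_matD[OF U]
  have lt: "i a < (d a)\<^sup>2" if "i \<in> ?P" "a \<in> {1..n}" for i a
    using that by (auto simp: PiE_iff)
  \<comment> \<open>Distinct indices give distinct operators, so summing over the set of operators
    counts each index once.\<close>
  have strength: "correlation_strength n d \<sigma> S M = (\<Sum>i\<in>?I. (mat_trace (M * ?T i))\<^sup>2)" for M
    unfolding correlation_strength_def correlation_operators_eq_image
    by (subst sum.reindex[OF inj_on_subset[OF inj_on_tensor_basis[OF s D] I]]) simp_all
  \<comment> \<open>The last premise says that exactly one of \<open>i\<close> and \<open>j\<close>
    has support \<open>S\<close>. At some party exactly one of the local indices is then 0, and the
    local block structure makes that factor vanish.\<close>
  have R0: "R i j = 0" if ij: "i \<in> ?P" "j \<in> ?P" and "i \<in> ?I \<longleftrightarrow> j \<notin> ?I" for i j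
  proof -
    have "{a\<in>{1..n}. i a \<noteq> 0} \<noteq> {a\<in>{1..n}. j a \<noteq> 0}"
      using that by (auto simp: correlation_indices_def)
    then obtain a where "(a \<in> {1..n} \<and> i a \<noteq> 0) \<noteq> (a \<in> {1..n} \<and> j a \<noteq> 0)"
      unfolding set_eq_iff mem_Collect_eq not_all ..
    then have a: "a \<in> {1..n}" "(i a = 0) \<noteq> (j a = 0)" by argo+
    then have "c a (i a) (j a) = 0"
      unfolding c_def
      by (intro conj_coeff_block[OF s[OF a(1)] d[OF a(1)] U[OF a(1)]] lt[OF ij(1) a(1)]
          lt[OF ij(2) a(1)])
    then show ?thesis unfolding R_def using a by (intro prod_zero) auto
  qed
  have orth: "(\<Sum>i\<in>?I. R i j * R i l) = (if j = l then 1 else 0)" if jl: "j \<in> ?I" "l \<in> ?I" for j l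
  proof -
    have jl': "j \<in> ?P" "l \<in> ?P" using jl I by auto
    \<comment> \<open>Rows outside \<open>?I\<close> contribute nothing to columns in
      \<open>?I\<close>, so the sum may run over the full product set, where it factors over the
      parties.\<close>
    have "(\<Sum>i\<in>?I. R i j * R i l) = (\<Sum>i\<in>?P. R i j * R i l)"
      using finP I jl jl' by (intro sum.mono_neutral_left) (auto simp: R0)
    also have "\<dots> = (\<Sum>i\<in>?P. \<Prod>a\<in>{1..n}. c a (i a) (j a) * c a (i a) (l a))"
      by (simp add: R_def prod.distrib)
    also have "\<dots> = (\<Prod>a\<in>{1..n}. \<Sum>m<(d a)\<^sup>2. c a m (j a) * c a m (l a))"
      by (intro prod_sum_PiE[symmetric]) auto
    also have "\<dots> = (\<Prod>a\<in>{1..n}. if j a = l a then 1 else 0)"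
      unfolding c_def using lt[OF jl'(1)] lt[OF jl'(2)]
      by (intro prod.cong refl conj_coeff_orthogonal s d U)
    also have "\<dots> = (if j = l then 1 else 0)"
    proof (cases "j = l")
      case False
      then obtain a where "a \<in> {1..n}" "j a \<noteq> l a"
        using PiE_ext[OF jl'] by blast
      then show ?thesis using False by auto
    qed simp
    finally show ?thesis .
  qed
  have transform:
    "mat_trace (tensor n U * \<rho> * mat_adjoint (tensor n U) * ?T i) = (\<Sum>j\<in>?I. R i j * t j)"
    if i: "i \<in> ?I" for i
  proof -
    have iP: "i \<in> ?P" using i I by auto
    have s_car: "\<sigma> a (j a) \<in> carrier_mat (d a) (d a)" if "j \<in> ?P" "a \<in> {1..n}" for j a
      by (rule local_operator_basisD(2)[OF s[OF that(2)] lt[OF that]])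
    have TU: "tensor n U \<in> carrier_mat ?D ?D" by (intro tensor_carrier U'(1))
    note Ti = tensor_basis_carrier[OF s iP]
    \<comment> \<open>Cyclicity moves the unitary from \<open>\<rho>\<close> to the basis operator,
      which is then conjugated factor by factor.\<close>
    have "mat_trace (tensor n U * \<rho> * mat_adjoint (tensor n U) * ?T i)
        = mat_trace (\<rho> * (mat_adjoint (tensor n U) * ?T i * tensor n U))"
      by (rule mat_trace_conjugate[OF \<rho> TU mat_adjoint_carrier[OF TU] Ti])
    also have "mat_adjoint (tensor n U) * ?T i * tensor n U
        = tensor n (\<lambda>a. mat_adjoint (U a)) * ?T i * tensor n U"
      by (subst tensor_adjoint[OF U'(1)]) simp_all
    also have "\<dots> = tensor n (\<lambda>a. mat_adjoint (U a) * \<sigma> a (i a)) * tensor n U"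
      by (subst tensor_mult[OF U'(2) s_car[OF iP]]) simp_all
    also have "\<dots> = tensor n (\<lambda>a. mat_adjoint (U a) * \<sigma> a (i a) * U a)"
      by (subst tensor_mult[OF mult_carrier_mat[OF U'(2) s_car[OF iP]] U'(1)]) simp_all
    also have "mat_trace (\<rho> * \<dots>) = (\<Sum>j\<in>?P. (\<Prod>a\<in>{1..n}. c a (i a) (j a)) * mat_trace (\<rho> * ?T j))"
    proof (rule mat_trace_mult_tensor_expand[OF \<rho>])
      fix a assume a: "a \<in> {1..n}"
      show car: "mat_adjoint (U a) * \<sigma> a (i a) * U a \<in> carrier_mat (d a) (d a)"
        using U'(1,2)[OF a] s_car[OF iP a] by (intro mult_carrier_mat)
      show "\<sigma> a j \<in> carrier_mat (d a) (d a)" if "j \<in> {..<(d a)\<^sup>2}" for j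
        using local_operator_basisD(2)[OF s[OF a]] that by simp
      show "finite {..<(d a)\<^sup>2}" by simp
      show "(mat_adjoint (U a) * \<sigma> a (i a) * U a) $$ (p, q)
          = (\<Sum>j<(d a)\<^sup>2. c a (i a) j * \<sigma> a j $$ (p, q))" if "p < d a" "q < d a" for p q
        unfolding c_def conj_coeff_def by (rule local_expansion[OF s[OF a] d[OF a] car that])
    qed
    also have "\<dots> = (\<Sum>j\<in>?P. R i j * t j)"
      by (simp add: R_def t_def)
    \<comment> \<open>Since \<open>i\<close> lies in \<open>?I\<close>, the block structure removes
      every \<open>j\<close> outside \<open>?I\<close>.\<close>
    also have "\<dots> = (\<Sum>j\<in>?I. R i j * t j)"
      using finP I i iP by (intro sum.mono_neutral_right) (auto simp: R0)
    finally show ?thesis .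
  qed
  have "correlation_strength n d \<sigma> S (tensor n U * \<rho> * mat_adjoint (tensor n U))
      = (\<Sum>i\<in>?I. \<Sum>j\<in>?I. \<Sum>l\<in>?I. t j * t l * (R i j * R i l))"
    unfolding strength
    by (intro sum.cong refl) (simp add: transform power2_eq_square sum_product mult_ac)
  \<comment> \<open>With the sum over \<open>i\<close> innermost, orthogonality of the columns of
    \<open>R\<close> keeps only the terms with \<open>j = l\<close>.\<close>
  also have "\<dots> = (\<Sum>j\<in>?I. \<Sum>l\<in>?I. \<Sum>i\<in>?I. t j * t l * (R i j * R i l))"
    by (rule sum_swap3)
  also have "\<dots> = (\<Sum>j\<in>?I. \<Sum>l\<in>?I. if j = l then t j * t l else 0)"
    by (intro sum.cong refl) (simp add: sum_distrib_left[symmetric] orth)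
  also have "\<dots> = (\<Sum>j\<in>?I. (t j)\<^sup>2)"
    by (simp add: sum.delta finite_correlation_indices power2_eq_square)
  also have "\<dots> = correlation_strength n d \<sigma> S \<rho>"
    by (simp add: strength t_def)
  finally show ?thesis .
qed

section \<open>Projection, trace formula and invariance for a density operator\<close>

theorem corollary1:
  fixes n :: nat
    and d :: "nat \<Rightarrow> nat"
    and \<sigma> :: "nat \<Rightarrow> nat \<Rightarrow> complex mat"
    and S :: "nat set"
    and \<rho> :: "complex mat"
  assumes "\<And>a. a \<in> {1..n} \<Longrightarrow> local_operator_basis (d a) (\<sigma> a)"
    and "S \<subseteq> {1..n}"
    and "density_operator (total_dim n d) \<rho>"
  shows "is_projection_onto (real_span (total_dim n d) (correlation_operators n d \<sigma> S)) \<rho>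
           (correlation_projection n d \<sigma> S \<rho>)
       \<and> correlation_strength n d \<sigma> S \<rho> =
           of_nat (total_dim n d) *
             mat_trace (correlation_projection n d \<sigma> S \<rho> * correlation_projection n d \<sigma> S \<rho>)
       \<and> (\<forall>U. (\<forall>a\<in>{1..n}. unitary_mat (d a) (U a)) \<longrightarrow>
            correlation_strength n d \<sigma> S (tensor n U * \<rho> * mat_adjoint (tensor n U)) =
            correlation_strength n d \<sigma> S \<rho>)"
proof -
  let ?D = "total_dim n d" and ?B = "correlation_operators n d \<sigma> S"
  have \<rho>: "\<rho> \<in> carrier_mat ?D ?D" "hermitian_mat \<rho>" "mat_trace \<rho> = 1"
    using assms(3) by (auto simp: density_operator_def)
  \<comment> \<open>In dimension 0 the trace of \<open>\<rho>\<close> would be an empty sum,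
    contradicting its value 1.\<close>
  have D: "?D > 0"
  proof (rule ccontr)
    assume "\<not> ?D > 0"
    with \<rho>(1) have "mat_trace \<rho> = 0" by (simp add: mat_trace_def)
    with \<rho>(3) show False by simp
  qed
  have fin: "finite ?B"
    by (simp add: correlation_operators_eq_image finite_correlation_indices)
  have obt: "\<exists>i\<in>(\<Pi>\<^sub>E a\<in>{1..n}. {..<(d a)\<^sup>2}). s = tensor n (\<lambda>a. \<sigma> a (i a))" if "s \<in> ?B" for s
    using that by (auto simp: correlation_operators_def)
  have car: "s \<in> carrier_mat ?D ?D" if "s \<in> ?B" for s
    using obt[OF that] tensor_basis_carrier[OF assms(1)] by auto
  \<comment> \<open>Hermitian \<open>\<rho>\<close> and \<open>s\<close> give real coefficients, as
    membership in a real span demands.\<close>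
  have "mat_trace (\<rho> * s) \<in> \<real>" if "s \<in> ?B" for s
    using obt[OF that] tensor_basis_hermitian[OF assms(1)] car[OF that]
    by (intro mat_trace_mult_hermitian_real[OF \<rho>(1) _ \<rho>(2)]) auto
  moreover have "mat_trace (s * t) = (if s = t then of_nat ?D else 0)" if st: "s \<in> ?B" "t \<in> ?B" for s t
  proof -
    obtain i j where ij: "i \<in> (\<Pi>\<^sub>E a\<in>{1..n}. {..<(d a)\<^sup>2})" "j \<in> (\<Pi>\<^sub>E a\<in>{1..n}. {..<(d a)\<^sup>2})"
      and eq: "s = tensor n (\<lambda>a. \<sigma> a (i a))" "t = tensor n (\<lambda>a. \<sigma> a (j a))"
      using obt[OF st(1)] obt[OF st(2)] by blast
    \<comment> \<open>Orthogonality is known in terms of indices; injectivity translates it into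
      equality of operators.\<close>
    have "s = t \<longleftrightarrow> i = j"
      unfolding eq using inj_on_eq_iff[OF inj_on_tensor_basis[OF assms(1) D] ij] by simp
    then show ?thesis
      using tensor_basis_orthogonal[OF assms(1) ij] eq by simp
  qed
  ultimately show ?thesis
    using orthogonal_projection[OF fin D \<rho>(1) car] correlation_strength_local_unitary[OF assms(1) D \<rho>(1)]
    by (auto simp: correlation_projection_def correlation_strength_def)
qed

end
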